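(* Let $\Omega\subset\mathbb{R}^d$ be a bounded Lipschitz domain, $s\in(0,1)$, $\alpha>0$, $f\in L^2(\Omega)$ and $g\in[L^2_s(\Omega^c)]'$, that is, $\int_{\Omega^c}|g(x)|^2(1+|x|^{d+2s})\,dx<\infty$. Then there exists a unique $u\in\mathbb{V}$ such that $$\langle u,v\rangle_{\mathbb{X}}+\alpha(u,v)_{L^2(\Omega)}=(f,v)_{L^2(\Omega)}+(g,v)_{L^2(\Omega^c)}\qquad\forall v\in\mathbb{V}.$$
   Context: $\Omega^c=\mathbb{R}^d\setminus\overline\Omega$, and $C_{d,s}=\frac{2^{2s}s\,\Gamma(s+d/2)}{\pi^{d/2}\Gamma(1-s)}$. $\langle u,v\rangle_{\mathbb{X}}=\frac{C_{d,s}}{2}\iint_{(\mathbb{R}^d\times\mathbb{R}^d)\setminus(\Omega^c\times\Omega^c)}\frac{(u(x)-u(y))(v(x)-v(y))}{|x-y|^{d+2s}}\,dx\,dy$, $|v|_{\mathbb{X}}=\langle v,v\rangle_{\mathbb{X}}^{1/2}$, $\|v\|_{\mathbb{V}}=(\|v\|_{L^2(\Omega)}^2+|v|_{\mathbb{X}}^2)^{1/2}$, and $\mathbb{V}=\{v:\mathbb{R}^d\to\mathbb{R}\text{ measurable}:\|v\|_{\mathbb{V}}<\infty\}$ (functions identified when equal a.e.). $(\cdot,\cdot)_{L^2(A)}$ denotes the integral over $A$ of the product. *)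

theory Defs
  imports "HOL-Analysis.Analysis"
begin

text \<open>
  Near each boundary point the set lies on one side of a Lipschitz graph, in coordinates given by
  a unit vector \<open>e\<close> (the graph direction) and its orthogonal complement (on which the
  graph function \<open>\<phi>\<close> is Lipschitz).
\<close>

definition Lipschitz_boundary :: "'a::euclidean_space set \<Rightarrow> bool" where
  "Lipschitz_boundary \<Omega> \<longleftrightarrow>
     (\<forall>p\<in>frontier \<Omega>. \<exists>e \<phi> L r. norm e = 1 \<and> r > 0 \<and>
        L-lipschitz_on {y. y \<bullet> e = 0} (\<phi> :: 'a \<Rightarrow> real) \<and>
        \<Omega> \<inter> ball p r = {x \<in> ball p r. x \<bullet> e > \<phi> (x - (x \<bullet> e) *\<^sub>R e)})"

definition bounded_Lipschitz_domain :: "'a::euclidean_space set \<Rightarrow> bool" where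
  "bounded_Lipschitz_domain \<Omega> \<longleftrightarrow>
     open \<Omega> \<and> connected \<Omega> \<and> \<Omega> \<noteq> {} \<and> bounded \<Omega> \<and> Lipschitz_boundary \<Omega>"

definition exterior :: "'a::euclidean_space set \<Rightarrow> 'a set" where
  "exterior \<Omega> = - closure \<Omega>"

definition frac_const :: "nat \<Rightarrow> real \<Rightarrow> real" where
  "frac_const d s =
     2 powr (2 * s) * s * Gamma (s + real d / 2) / (pi powr (real d / 2) * Gamma (1 - s))"

definition L2_inner :: "'a::euclidean_space set \<Rightarrow> ('a \<Rightarrow> real) \<Rightarrow> ('a \<Rightarrow> real) \<Rightarrow> real" where
  "L2_inner A u v = (LINT x:A|lebesgue. u x * v x)"

definition L2_norm_sq :: "'a::euclidean_space set \<Rightarrow> ('a \<Rightarrow> real) \<Rightarrow> ennreal" where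
  "L2_norm_sq A v = (\<integral>\<^sup>+x\<in>A. ennreal ((v x)\<^sup>2) \<partial>lebesgue)"

definition L2_space :: "'a::euclidean_space set \<Rightarrow> ('a \<Rightarrow> real) set" where
  "L2_space A = {f. set_borel_measurable lebesgue A f \<and> L2_norm_sq A f < \<infinity>}"

definition dual_L2s_space :: "'a::euclidean_space set \<Rightarrow> real \<Rightarrow> ('a \<Rightarrow> real) set" where
  "dual_L2s_space A s = {g. set_borel_measurable lebesgue A g \<and>
     (\<integral>\<^sup>+x\<in>A. ennreal ((g x)\<^sup>2 * (1 + norm x powr (real DIM('a) + 2 * s))) \<partial>lebesgue) < \<infinity>}"

text \<open>
  On the (null) diagonal the kernel below has value 0, as division by zero yields zero.
\<close>

definition X_integrand ::
  "real \<Rightarrow> ('a::euclidean_space \<Rightarrow> real) \<Rightarrow> ('a \<Rightarrow> real) \<Rightarrow> 'a \<times> 'a \<Rightarrow> real" where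
  "X_integrand s u v = (\<lambda>(x, y).
     (u x - u y) * (v x - v y) / norm (x - y) powr (real DIM('a) + 2 * s))"

definition X_region :: "'a::euclidean_space set \<Rightarrow> ('a \<times> 'a) set" where
  "X_region \<Omega> = UNIV - exterior \<Omega> \<times> exterior \<Omega>"

definition X_inner ::
  "'a::euclidean_space set \<Rightarrow> real \<Rightarrow> ('a \<Rightarrow> real) \<Rightarrow> ('a \<Rightarrow> real) \<Rightarrow> real" where
  "X_inner \<Omega> s u v =
     frac_const DIM('a) s / 2 * (LINT z:X_region \<Omega>|lebesgue. X_integrand s u v z)"

text \<open>
  The squared seminorm and norm take values in \<^typ>\<open>ennreal\<close>, so that finiteness can be
  expressed: the Bochner integral in \<^const>\<open>X_inner\<close> is 0 for non-integrable functions.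
\<close>

definition X_seminorm_sq :: "'a::euclidean_space set \<Rightarrow> real \<Rightarrow> ('a \<Rightarrow> real) \<Rightarrow> ennreal" where
  "X_seminorm_sq \<Omega> s v =
     ennreal (frac_const DIM('a) s / 2) *
       (\<integral>\<^sup>+z\<in>X_region \<Omega>. ennreal (X_integrand s v v z) \<partial>lebesgue)"

definition V_norm_sq :: "'a::euclidean_space set \<Rightarrow> real \<Rightarrow> ('a \<Rightarrow> real) \<Rightarrow> ennreal" where
  "V_norm_sq \<Omega> s v = L2_norm_sq \<Omega> v + X_seminorm_sq \<Omega> s v"

text \<open>Elements are representatives of classes modulo a.e. equality on the whole space; uniqueness is
  accordingly stated up to a.e. equality.\<close>

definition V_space :: "'a::euclidean_space set \<Rightarrow> real \<Rightarrow> ('a \<Rightarrow> real) set" where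
  "V_space \<Omega> s = {v \<in> borel_measurable lebesgue. V_norm_sq \<Omega> s v < \<infinity>}"

definition weak_solution ::
  "'a::euclidean_space set \<Rightarrow> real \<Rightarrow> real \<Rightarrow> ('a \<Rightarrow> real) \<Rightarrow> ('a \<Rightarrow> real) \<Rightarrow> ('a \<Rightarrow> real) \<Rightarrow> bool" where
  "weak_solution \<Omega> s \<alpha> f g u \<longleftrightarrow> u \<in> V_space \<Omega> s \<and>
     (\<forall>v\<in>V_space \<Omega> s.
        X_inner \<Omega> s u v + \<alpha> * L2_inner \<Omega> u v = L2_inner \<Omega> f v + L2_inner (exterior \<Omega>) g v)"

end

theory Submission
  imports Defs
begin

text \<open>
  The weak formulation is the Euler equation of the quadratic functional
  \<open>v \<mapsto> B v v - 2 * F v\<close>, where \<open>B\<close> is the energy form \<^const>\<open>X_inner\<close> plus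
  \<open>\<alpha>\<close> times the \<open>L\<^sup>2(\<Omega>)\<close> product and \<open>F\<close> is the load given by \<open>f\<close> and \<open>g\<close>. Existence is the Riesz
  representation theorem for \<open>B\<close>; it needs that \<open>F\<close> is controlled by \<open>B\<close> and that the
  space is complete. Uniqueness needs that \<open>B d d = 0\<close> forces \<open>d = 0\<close> almost everywhere on the
  whole space, not only on \<open>\<Omega>\<close>.

  One inequality (\<open>weighted_L2_le_energy\<close>) yields all three. It bounds the integral of
  \<open>v\<^sup>2 / (1 + \<bar>x\<bar>\<^bsup>d+2s\<^esup>)\<close> over the whole space by a multiple of \<open>B v v\<close>. To see it, compare \<open>v x\<close> with
  \<open>v y\<close> for \<open>y \<in> \<Omega>\<close>: since \<open>\<Omega>\<close> is bounded, the kernel \<open>\<bar>x - y\<bar>\<^bsup>-d-2s\<^esup>\<close> is at least a multiple of the weight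
  \<open>1 / (1 + \<bar>x\<bar>\<^bsup>d+2s\<^esup>)\<close>, so averaging
  \<open>(v x)\<^sup>2 \<le> 2 (v y)\<^sup>2 + 2 (v x - v y)\<^sup>2\<close> over \<open>y \<in> \<Omega>\<close> against the weight produces
  the two parts of the energy; the first of them needs the weight to be integrable.

  The weight is exactly dual to the one in the hypothesis on \<open>g\<close>, so Young's inequality
  bounds the load (\<open>L2_inner_dual_bound\<close>). A sequence whose successive energy distances decay
  geometrically converges almost everywhere because its increments are summable in the
  weighted \<open>L\<^sup>2\<close> space, and Fatou's lemma turns the pointwise limit into a limit in energy
  (\<open>V_space_complete\<close>). Finally, vanishing energy means a vanishing weighted integral
  (\<open>energy_zero_imp_AE_zero\<close>).
\<close>

section \<open>Riesz representation by energy minimisation\<close>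

lemma nonneg_quadratic_discriminant:
  fixes a b c :: real
  assumes nonneg: "\<And>t. 0 \<le> c + 2 * t * a + t\<^sup>2 * b" and "0 \<le> b"
  shows "a\<^sup>2 \<le> b * c"
proof (cases "b = 0")
  case True
  have "0 \<le> c" using nonneg[of 0] by simp
  have "a = 0"
  proof (rule ccontr)
    assume "a \<noteq> 0"
    then show False using nonneg[of "- (c + 1) / (2 * a)"] True \<open>0 \<le> c\<close>
      by (simp add: field_simps)
  qed
  then show ?thesis using True by simp
next
  case False
  then have "0 \<le> b * (c + 2 * (- a / b) * a + (- a / b)\<^sup>2 * b)"
    using nonneg[of "- a / b"] \<open>0 \<le> b\<close> by simp
  also have "\<dots> = b * c - a\<^sup>2"
    using False by (simp add: field_simps power2_eq_square)
  finally show ?thesis by simp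
qed

text \<open>
  The representing element is the limit of a minimising sequence of \<open>v \<mapsto> B v v - 2 * F v\<close>.
  Near-optimality of the terms is used twice: through the parallelogram law it makes the sequence
  Cauchy, and through the discriminant of \<open>t \<mapsto> q (X n + t * v)\<close> it makes the residual
  \<open>B (X n) v - F v\<close> small.

  The space is a set of functions closed under \<open>u + t * v\<close>, since square integrable functions
  are representatives and not classes; \<open>B\<close> is accordingly only semidefinite. Boundedness of
  \<open>F\<close> enters as a lower bound of the functional. Completeness is stated for sequences
  with a geometric rate, which the minimising sequence can be chosen to have.
\<close>

lemma Riesz_representation_by_minimisation:
  fixes V :: "('b \<Rightarrow> real) set" and B :: "('b \<Rightarrow> real) \<Rightarrow> ('b \<Rightarrow> real) \<Rightarrow> real"
  assumes V_ne: "V \<noteq> {}"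
    and V_lin: "\<And>u v t. u \<in> V \<Longrightarrow> v \<in> V \<Longrightarrow> (\<lambda>x. u x + t * v x) \<in> V"
    and B_lin: "\<And>u v w t. u \<in> V \<Longrightarrow> v \<in> V \<Longrightarrow> w \<in> V \<Longrightarrow>
                  B (\<lambda>x. u x + t * v x) w = B u w + t * B v w"
    and B_sym: "\<And>u v. u \<in> V \<Longrightarrow> v \<in> V \<Longrightarrow> B u v = B v u"
    and B_nonneg: "\<And>v. v \<in> V \<Longrightarrow> 0 \<le> B v v"
    and F_lin: "\<And>u v t. u \<in> V \<Longrightarrow> v \<in> V \<Longrightarrow> F (\<lambda>x. u x + t * v x) = F u + t * F v"
    and F_bound: "\<And>v. v \<in> V \<Longrightarrow> 2 * F v \<le> B v v + K"
    and complete: "\<And>X. (\<And>n. X n \<in> V) \<Longrightarrow>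
        (\<And>m n. n \<le> m \<Longrightarrow> B (\<lambda>x. X m x - X n x) (\<lambda>x. X m x - X n x) \<le> (1/4) ^ n) \<Longrightarrow>
        \<exists>u\<in>V. (\<lambda>n. B (\<lambda>x. u x - X n x) (\<lambda>x. u x - X n x)) \<longlonglongrightarrow> 0"
  shows "\<exists>u\<in>V. \<forall>v\<in>V. B u v = F v"
proof -
  define q where "q v = B v v - 2 * F v" for v
  have diff_eq: "(\<lambda>x. u x - v x) = (\<lambda>x. u x + (-1) * v x)" for u v :: "'b \<Rightarrow> real"
    by simp
  have V_diff: "(\<lambda>x. u x - v x) \<in> V" if "u \<in> V" "v \<in> V" for u v
    unfolding diff_eq using that by (rule V_lin)
  have B_diff: "B (\<lambda>x. u x - v x) w = B u w - B v w" if "u \<in> V" "v \<in> V" "w \<in> V" for u v w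
    unfolding diff_eq using B_lin[OF that, of "-1"] by simp
  have B_expand: "B (\<lambda>x. u x + t * v x) (\<lambda>x. u x + t * v x) = B u u + 2 * t * B u v + t\<^sup>2 * B v v"
    if u: "u \<in> V" and v: "v \<in> V" for u v t
  proof -
    have w: "(\<lambda>x. u x + t * v x) \<in> V" using u v by (rule V_lin)
    have "B (\<lambda>x. u x + t * v x) (\<lambda>x. u x + t * v x)
        = B (\<lambda>x. u x + t * v x) u + t * B (\<lambda>x. u x + t * v x) v"
      using B_lin[OF u v w] B_sym[OF u w] B_sym[OF v w] by simp
    also have "\<dots> = B u u + 2 * t * B u v + t\<^sup>2 * B v v"
      using B_lin[OF u v u] B_lin[OF u v v] B_sym[OF u v]
      by (simp add: power2_eq_square algebra_simps)
    finally show ?thesis .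
  qed
  have q_expand: "q (\<lambda>x. u x + t * v x) = q u + 2 * t * (B u v - F v) + t\<^sup>2 * B v v"
    if "u \<in> V" "v \<in> V" for u v t
    using B_expand[OF that] F_lin[OF that] by (simp add: q_def algebra_simps)
  have Cauchy_Schwarz: "(B u v)\<^sup>2 \<le> B v v * B u u" if "u \<in> V" "v \<in> V" for u v
    by (rule nonneg_quadratic_discriminant)
      (use B_expand[OF that] B_nonneg[OF V_lin[OF that]] B_nonneg[OF that(2)] in simp_all)
  define m where "m = (INF v\<in>V. q v)"
  have bdd: "bdd_below (q ` V)"
    by (rule bdd_belowI2[of _ "- K"]) (use F_bound in \<open>force simp: q_def\<close>)
  have m_le: "m \<le> q v" if "v \<in> V" for v
    unfolding m_def using bdd that by (rule cINF_lower)
  have "\<exists>v\<in>V. q v < m + (1/4) ^ n / 4" for n :: nat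
    using cINF_less_iff[OF V_ne bdd, of "m + (1/4) ^ n / 4"] by (simp add: m_def)
  then obtain X where X: "\<And>n. X n \<in> V" and qX: "\<And>n :: nat. q (X n) < m + (1/4) ^ n / 4"
    by metis
  have close: "B (\<lambda>x. X k x - X n x) (\<lambda>x. X k x - X n x) \<le> (1/4) ^ n" if "n \<le> k" for k n
  proof -
    define w where "w = (\<lambda>x. X k x - X n x)"
    have w: "w \<in> V" unfolding w_def by (intro V_diff X)
    have Xk: "X k = (\<lambda>x. X n x + 1 * w x)" by (simp add: w_def)
    \<comment> \<open>The parallelogram law: the midpoint of two almost minimisers has value at least \<open>m\<close>.\<close>
    have "m \<le> q (X n) + (B (X n) w - F w) + B w w / 4"
      using m_le[OF V_lin[OF X w, of n "1/2"]] unfolding q_expand[OF X w]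
      by (simp add: power2_eq_square)
    moreover have "q (X k) = q (X n) + 2 * (B (X n) w - F w) + B w w"
      using q_expand[OF X w, of n 1] Xk by simp
    moreover have "(1/4 :: real) ^ k \<le> (1/4) ^ n"
      using that by (intro power_decreasing) auto
    moreover have "b \<le> e"
      if "l \<le> y + a + b / 4" "z = y + 2 * a + b" "e' \<le> e" "y < l + e / 4" "z < l + e' / 4"
      for a b l y z e e' :: real
      using that by (simp add: field_simps)
    ultimately have "B w w \<le> (1/4) ^ n" using qX[of n] qX[of k] by blast
    then show ?thesis by (simp add: w_def)
  qed
  obtain u where u: "u \<in> V" and lim: "(\<lambda>n. B (\<lambda>x. u x - X n x) (\<lambda>x. u x - X n x)) \<longlonglongrightarrow> 0"
    using complete[OF X close] by auto
  have "B u v = F v" if v: "v \<in> V" for v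
  proof -
    have bound: "(B u v - F v)\<^sup>2 \<le>
        2 * (B v v * (1/4) ^ n) + 2 * (B v v * B (\<lambda>x. u x - X n x) (\<lambda>x. u x - X n x))" for n
    proof -
      have "(B (X n) v - F v)\<^sup>2 \<le> B v v * ((1/4) ^ n / 4)"
      proof (rule nonneg_quadratic_discriminant)
        fix t
        show "0 \<le> (1/4) ^ n / 4 + 2 * t * (B (X n) v - F v) + t\<^sup>2 * B v v"
          using m_le[OF V_lin[OF X v, of n t]] qX[of n] q_expand[OF X v, of n t] by linarith
      qed (rule B_nonneg[OF v])
      also have "\<dots> \<le> B v v * (1/4) ^ n"
        using B_nonneg[OF v] by (intro mult_left_mono) auto
      finally have "(B (X n) v - F v)\<^sup>2 \<le> B v v * (1/4) ^ n" .
      moreover have "(B u v - B (X n) v)\<^sup>2 \<le> B v v * B (\<lambda>x. u x - X n x) (\<lambda>x. u x - X n x)"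
        using Cauchy_Schwarz[OF V_diff[OF u X] v, of n] B_diff[OF u X v, of n] by simp
      moreover have "(B u v - F v)\<^sup>2 \<le> 2 * (B (X n) v - F v)\<^sup>2 + 2 * (B u v - B (X n) v)\<^sup>2"
      proof -
        have "0 \<le> ((B (X n) v - F v) - (B u v - B (X n) v))\<^sup>2" by simp
        then show ?thesis by (simp add: power2_eq_square algebra_simps)
      qed
      ultimately show ?thesis by linarith
    qed
    have "(\<lambda>n. 2 * (B v v * (1/4) ^ n) + 2 * (B v v * B (\<lambda>x. u x - X n x) (\<lambda>x. u x - X n x)))
        \<longlonglongrightarrow> 2 * (B v v * 0) + 2 * (B v v * 0)"
      by (intro tendsto_intros LIMSEQ_power_zero lim) simp
    then have "(B u v - F v)\<^sup>2 \<le> 2 * (B v v * 0) + 2 * (B v v * 0)"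
      by (rule LIMSEQ_le_const) (use bound in auto)
    then show ?thesis by simp
  qed
  with u show ?thesis by blast
qed

section \<open>Square integrable functions\<close>

definition square_integrable :: "'b measure \<Rightarrow> ('b \<Rightarrow> real) \<Rightarrow> bool" where
  "square_integrable M \<phi> \<longleftrightarrow>
     \<phi> \<in> borel_measurable M \<and> (\<integral>\<^sup>+x. ennreal ((\<phi> x)\<^sup>2) \<partial>M) < \<infinity>"

lemma square_integrable_measurable [measurable_dest]:
  "square_integrable M \<phi> \<Longrightarrow> \<phi> \<in> borel_measurable M"
  by (simp add: square_integrable_def)

lemma square_integrable_mult:
  assumes "square_integrable M \<phi>" "square_integrable M \<psi>"
  shows "integrable M (\<lambda>x. \<phi> x * \<psi> x)"
proof -
  note [measurable] = assms[THEN square_integrable_measurable]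
  have sq: "integrable M (\<lambda>x. (\<phi> x)\<^sup>2)" "integrable M (\<lambda>x. (\<psi> x)\<^sup>2)"
    using assms by (auto simp: square_integrable_def intro!: integrableI_nonneg)
  show ?thesis
  proof (rule Bochner_Integration.integrable_bound)
    show "integrable M (\<lambda>x. (\<phi> x)\<^sup>2 + (\<psi> x)\<^sup>2)" using sq by simp
    have "\<bar>a * b\<bar> \<le> a\<^sup>2 + b\<^sup>2" for a b :: real
    proof -
      have "0 \<le> (\<bar>a\<bar> - \<bar>b\<bar>)\<^sup>2" "0 \<le> \<bar>a * b\<bar>" by simp_all
      then have "\<bar>a * b\<bar> \<le> a\<^sup>2 + b\<^sup>2 - \<bar>a * b\<bar>"
        by (simp add: power2_diff abs_mult)
      then show ?thesis using \<open>0 \<le> \<bar>a * b\<bar>\<close> by linarith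
    qed
    then show "AE x in M. norm (\<phi> x * \<psi> x) \<le> norm ((\<phi> x)\<^sup>2 + (\<psi> x)\<^sup>2)" by simp
  qed simp
qed

lemma square_integrable_integral_sq:
  assumes "square_integrable M \<phi>"
  shows "ennreal (\<integral>x. \<phi> x * \<phi> x \<partial>M) = (\<integral>\<^sup>+x. ennreal ((\<phi> x)\<^sup>2) \<partial>M)"
  using nn_integral_eq_integral[OF square_integrable_mult[OF assms assms]]
  by (simp add: power2_eq_square)

text \<open>
  The integrated form of \<open>0 \<le> (\<phi> - \<delta> * \<psi>)\<^sup>2 / \<delta>\<close>. It replaces the Cauchy--Schwarz inequality: the free
  parameter lets the second term be absorbed into the energy.
\<close>

lemma square_integrable_Young:
  assumes "square_integrable M \<phi>" "square_integrable M \<psi>" "\<delta> > 0"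
  shows "2 * (\<integral>x. \<phi> x * \<psi> x \<partial>M) \<le> (\<integral>x. \<phi> x * \<phi> x \<partial>M) / \<delta> + \<delta> * (\<integral>x. \<psi> x * \<psi> x \<partial>M)"
proof -
  have "2 * (\<integral>x. \<phi> x * \<psi> x \<partial>M) = (\<integral>x. 2 * (\<phi> x * \<psi> x) \<partial>M)" by simp
  also have "\<dots> \<le> (\<integral>x. \<phi> x * \<phi> x / \<delta> + \<delta> * (\<psi> x * \<psi> x) \<partial>M)"
  proof (rule integral_mono)
    fix x
    have "0 \<le> (\<phi> x - \<delta> * \<psi> x)\<^sup>2 / \<delta>" using \<open>\<delta> > 0\<close> by simp
    also have "\<dots> = \<phi> x * \<phi> x / \<delta> + \<delta> * (\<psi> x * \<psi> x) - 2 * (\<phi> x * \<psi> x)"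
      using \<open>\<delta> > 0\<close> by (simp add: field_simps power2_eq_square)
    finally show "2 * (\<phi> x * \<psi> x) \<le> \<phi> x * \<phi> x / \<delta> + \<delta> * (\<psi> x * \<psi> x)" by simp
  qed (use assms in \<open>auto intro!: integrable_mult_right integrable_divide_zero square_integrable_mult\<close>)
  also have "\<dots> = (\<integral>x. \<phi> x * \<phi> x \<partial>M) / \<delta> + \<delta> * (\<integral>x. \<psi> x * \<psi> x \<partial>M)"
    using square_integrable_mult[OF assms(1,1)] square_integrable_mult[OF assms(2,2)] by simp
  finally show ?thesis .
qed

lemma square_integrable_lincomb:
  assumes "square_integrable M \<phi>" "square_integrable M \<psi>"
  shows "square_integrable M (\<lambda>x. \<phi> x + t * \<psi> x)"
proof -
  note [measurable] = assms[THEN square_integrable_measurable]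
  have "integrable M (\<lambda>x. \<phi> x * \<phi> x + 2 * t * (\<phi> x * \<psi> x) + t\<^sup>2 * (\<psi> x * \<psi> x))"
    using square_integrable_mult[OF assms(1,1)] square_integrable_mult[OF assms(1,2)]
      square_integrable_mult[OF assms(2,2)] by simp
  also have "(\<lambda>x. \<phi> x * \<phi> x + 2 * t * (\<phi> x * \<psi> x) + t\<^sup>2 * (\<psi> x * \<psi> x))
      = (\<lambda>x. (\<phi> x + t * \<psi> x)\<^sup>2)"
    by (simp add: power2_eq_square algebra_simps)
  finally show ?thesis
    by (auto simp: square_integrable_def integrable_iff_bounded)
qed

lemma Fatou_square:
  assumes [measurable]: "\<And>n. \<phi> n \<in> borel_measurable M" and [measurable]: "\<psi> \<in> borel_measurable M"
    and lim: "AE x in M. (\<lambda>n. \<phi> n x) \<longlonglongrightarrow> \<psi> x"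
    and bound: "\<And>n. n \<ge> N \<Longrightarrow> (\<integral>\<^sup>+x. ennreal ((\<phi> n x)\<^sup>2) \<partial>M) \<le> C"
  shows "(\<integral>\<^sup>+x. ennreal ((\<psi> x)\<^sup>2) \<partial>M) \<le> C"
proof -
  have "(\<integral>\<^sup>+x. ennreal ((\<psi> x)\<^sup>2) \<partial>M) = (\<integral>\<^sup>+x. liminf (\<lambda>n. ennreal ((\<phi> n x)\<^sup>2)) \<partial>M)"
  proof (rule nn_integral_cong_AE)
    show "AE x in M. ennreal ((\<psi> x)\<^sup>2) = liminf (\<lambda>n. ennreal ((\<phi> n x)\<^sup>2))"
      using lim
    proof eventually_elim
      case (elim x)
      then have "(\<lambda>n. ennreal ((\<phi> n x)\<^sup>2)) \<longlonglongrightarrow> ennreal ((\<psi> x)\<^sup>2)"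
        by (intro tendsto_ennrealI tendsto_power)
      then show ?case by (intro lim_imp_Liminf[symmetric]) simp_all
    qed
  qed
  also have "\<dots> \<le> liminf (\<lambda>n. \<integral>\<^sup>+x. ennreal ((\<phi> n x)\<^sup>2) \<partial>M)"
    by (rule nn_integral_liminf) simp
  also have "\<dots> \<le> liminf (\<lambda>n. C)"
    using bound by (intro Liminf_mono) (auto simp: eventually_sequentially)
  finally show ?thesis by (simp add: Liminf_const)
qed

section \<open>Lebesgue measure on pairs\<close>

text \<open>
  Lebesgue measure on pairs is not the product of the Lebesgue measures but its completion. The
  projections are measurable all the same, because the preimage of a null set is a product with
  a null factor.
\<close>

lemma measurable_fst_lebesgue [measurable]:
  "fst \<in> (lebesgue :: ('a::euclidean_space \<times> 'b::euclidean_space) measure) \<rightarrow>\<^sub>M lebesgue"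
proof (rule completion.measurable_completion2)
  have borel: "fst \<in> (borel :: ('a \<times> 'b) measure) \<rightarrow>\<^sub>M borel"
    by (intro borel_measurable_continuous_onI continuous_intros)
  then show leb: "fst \<in> (lebesgue :: ('a \<times> 'b) measure) \<rightarrow>\<^sub>M lborel"
    by (simp add: measurable_completion)
  show "null_sets lborel \<subseteq> null_sets (distr (lebesgue :: ('a \<times> 'b) measure) lborel fst)"
  proof
    fix N :: "'a set" assume N: "N \<in> null_sets lborel"
    have "emeasure (lborel \<Otimes>\<^sub>M lborel) (N \<times> (UNIV :: 'b set)) = 0"
      using N by (subst lborel.emeasure_pair_measure_Times) auto
    moreover have "fst -` N = N \<times> (UNIV :: 'b set)" by auto
    moreover have "N \<times> (UNIV :: 'b set) \<in> sets borel"
      using N by (auto intro!: borel_Times)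
    ultimately show "N \<in> null_sets (distr (lebesgue :: ('a \<times> 'b) measure) lborel fst)"
      using N leb by (auto simp: null_sets_def emeasure_distr lborel_prod)
  qed
qed

lemma measurable_snd_lebesgue [measurable]:
  "snd \<in> (lebesgue :: ('a::euclidean_space \<times> 'b::euclidean_space) measure) \<rightarrow>\<^sub>M lebesgue"
proof (rule completion.measurable_completion2)
  have borel: "snd \<in> (borel :: ('a \<times> 'b) measure) \<rightarrow>\<^sub>M borel"
    by (intro borel_measurable_continuous_onI continuous_intros)
  then show leb: "snd \<in> (lebesgue :: ('a \<times> 'b) measure) \<rightarrow>\<^sub>M lborel"
    by (simp add: measurable_completion)
  show "null_sets lborel \<subseteq> null_sets (distr (lebesgue :: ('a \<times> 'b) measure) lborel snd)"
  proof
    fix N :: "'b set" assume N: "N \<in> null_sets lborel"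
    have "emeasure (lborel \<Otimes>\<^sub>M lborel) ((UNIV :: 'a set) \<times> N) = 0"
      using N by (subst lborel.emeasure_pair_measure_Times) auto
    moreover have "snd -` N = (UNIV :: 'a set) \<times> N" by auto
    moreover have "(UNIV :: 'a set) \<times> N \<in> sets borel"
      using N by (auto intro!: borel_Times)
    ultimately show "N \<in> null_sets (distr (lebesgue :: ('a \<times> 'b) measure) lborel snd)"
      using N leb by (auto simp: null_sets_def emeasure_distr lborel_prod)
  qed
qed

lemma AE_lebesgue_pair:
  fixes P :: "'a::euclidean_space \<Rightarrow> bool"
  assumes "AE x in lebesgue. P x"
  shows "AE z in (lebesgue :: ('a \<times> 'a) measure). P (fst z) \<and> P (snd z)"
proof -
  obtain N where N: "N \<in> null_sets lborel" "{x. \<not> P x} \<subseteq> N"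
    using assms unfolding AE_completion_iff by (auto simp: eventually_ae_filter)
  have "emeasure (lborel \<Otimes>\<^sub>M lborel) (N \<times> (UNIV :: 'a set)) = 0"
    "emeasure (lborel \<Otimes>\<^sub>M lborel) ((UNIV :: 'a set) \<times> N) = 0"
    using N by (subst lborel.emeasure_pair_measure_Times; auto)+
  moreover have "N \<times> (UNIV :: 'a set) \<in> sets borel" "(UNIV :: 'a set) \<times> N \<in> sets borel"
    using N by (auto intro!: borel_Times)
  ultimately have "N \<times> UNIV \<union> UNIV \<times> N \<in> null_sets (lborel :: ('a \<times> 'a) measure)"
    by (intro null_sets.Un) (auto simp: null_sets_def lborel_prod)
  then have "AE z in (lborel :: ('a \<times> 'a) measure). P (fst z) \<and> P (snd z)"
    by (rule AE_I') (use N(2) in auto)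
  then show ?thesis by (rule AE_completion)
qed

text \<open>
  Tonelli for a product of functions of one variable each. Replacing both by Borel representatives moves the
  claim from the completed measure to the genuine product measure.
\<close>

lemma nn_integral_lebesgue_pair_mult:
  fixes \<phi> \<psi> :: "'a::euclidean_space \<Rightarrow> ennreal"
  assumes "\<phi> \<in> borel_measurable lebesgue" "\<psi> \<in> borel_measurable lebesgue"
  shows "(\<integral>\<^sup>+z. \<phi> (fst z) * \<psi> (snd z) \<partial>lebesgue) = (\<integral>\<^sup>+x. \<phi> x \<partial>lebesgue) * (\<integral>\<^sup>+x. \<psi> x \<partial>lebesgue)"
proof -
  obtain \<phi>' where [measurable]: "\<phi>' \<in> borel_measurable lborel" and \<phi>': "AE x in lborel. \<phi> x = \<phi>' x"
    using completion_ex_borel_measurable[OF assms(1)] by blast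
  obtain \<psi>' where [measurable]: "\<psi>' \<in> borel_measurable lborel" and \<psi>': "AE x in lborel. \<psi> x = \<psi>' x"
    using completion_ex_borel_measurable[OF assms(2)] by blast
  have "(\<integral>\<^sup>+z. \<phi> (fst z) * \<psi> (snd z) \<partial>lebesgue) = (\<integral>\<^sup>+z. \<phi>' (fst z) * \<psi>' (snd z) \<partial>(lebesgue :: ('a \<times> 'a) measure))"
    using AE_lebesgue_pair[OF AE_completion[OF \<phi>']] AE_lebesgue_pair[OF AE_completion[OF \<psi>']]
    by (intro nn_integral_cong_AE) auto
  also have "\<dots> = (\<integral>\<^sup>+z. \<phi>' (fst z) * \<psi>' (snd z) \<partial>(lborel \<Otimes>\<^sub>M lborel))"
    by (simp add: nn_integral_completion lborel_prod)
  also have "\<dots> = (\<integral>\<^sup>+x. \<integral>\<^sup>+y. \<phi>' x * \<psi>' y \<partial>lborel \<partial>lborel)"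
    by (subst lborel.nn_integral_fst[symmetric]) auto
  also have "\<dots> = (\<integral>\<^sup>+x. \<phi>' x \<partial>lborel) * (\<integral>\<^sup>+x. \<psi>' x \<partial>lborel)"
    by (simp add: nn_integral_cmult nn_integral_multc)
  also have "\<dots> = (\<integral>\<^sup>+x. \<phi> x \<partial>lebesgue) * (\<integral>\<^sup>+x. \<psi> x \<partial>lebesgue)"
    using \<phi>' \<psi>' by (simp add: nn_integral_completion cong: nn_integral_cong_AE)
  finally show ?thesis .
qed

section \<open>The weight at infinity\<close>

definition tail_weight :: "real \<Rightarrow> 'a::euclidean_space \<Rightarrow> real" where
  "tail_weight s x = 1 + norm x powr (real DIM('a) + 2 * s)"

lemma tail_weight_ge_1: "1 \<le> tail_weight s x"
  by (simp add: tail_weight_def)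

lemma tail_weight_pos: "0 < tail_weight s x"
  using tail_weight_ge_1[of s x] by linarith

lemma borel_measurable_tail_weight [measurable]:
  "tail_weight s \<in> borel_measurable borel"
  unfolding tail_weight_def[abs_def] by measurable

lemma lebesgue_measurable_tail_weight [measurable]:
  "tail_weight s \<in> borel_measurable lebesgue"
  by (intro measurable_completion) simp

lemma ex_dyadic_shell:
  fixes r :: real
  assumes "1 \<le> r"
  shows "\<exists>k::nat. 2 ^ k \<le> r \<and> r < 2 ^ Suc k"
proof -
  define k where "k = nat \<lfloor>log 2 r\<rfloor>"
  have "0 \<le> log 2 r" using assms by simp
  then have "real k \<le> log 2 r" "log 2 r < real (Suc k)"
    unfolding k_def by linarith+
  then have "2 powr real k \<le> r" "r < 2 powr real (Suc k)"
    using assms by (simp_all only: le_log_iff log_less_iff)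
  then show ?thesis by (intro exI[of _ k]) (simp add: powr_realpow del: of_nat_Suc power_Suc)
qed

text \<open>
  On the dyadic shell \<open>2\<^sup>k \<le> \<bar>x\<bar> < 2\<^bsup>k+1\<^esup>\<close> the integrand is at most \<open>2\<^bsup>-k(d+2s)\<^esup>\<close>, and the shell has volume of
  order \<open>2\<^bsup>kd\<^esup>\<close>; the contributions form a geometric series of ratio \<open>2\<^bsup>-2s\<^esup>\<close>.
\<close>

lemma integral_inverse_tail_weight_finite:
  assumes "0 < s"
  shows "(\<integral>\<^sup>+x. ennreal (1 / tail_weight s (x::'a::euclidean_space)) \<partial>lborel) < \<infinity>"
proof -
  define p where "p = real DIM('a) + 2 * s"
  define U where "U = measure lborel (ball (0::'a) 1)"
  have ball: "emeasure lborel (ball (0::'a) r) = ennreal (r ^ DIM('a) * U)" if "r \<ge> 0" for r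
    using content_ball_conv_unit_ball[OF that, of "0::'a"] emeasure_lborel_ball_finite[of "0::'a" r]
    by (simp add: emeasure_eq_ennreal_measure U_def)
  define a where "a k = 2 powr (- real k * p) * (2 ^ Suc k) ^ DIM('a) * U" for k :: nat
  have a_eq: "a k = 2 ^ DIM('a) * U * (2 powr (- 2 * s)) ^ k" for k
  proof -
    have "2 powr (- real k * p) * (2 ^ Suc k) ^ DIM('a)
        = 2 powr (- real k * p) * 2 powr (real (Suc k) * real DIM('a))"
      by (simp only: powr_power powr_realpow[symmetric]) (simp add: powr_powr mult.commute)
    also have "\<dots> = 2 powr (real DIM('a) + real k * (- 2 * s))"
      by (simp add: p_def algebra_simps flip: powr_add)
    also have "\<dots> = 2 ^ DIM('a) * (2 powr (- 2 * s)) ^ k"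
      by (subst powr_add) (simp add: powr_realpow powr_power mult.commute)
    finally show ?thesis by (simp add: a_def)
  qed
  have "2 powr (- 2 * s) < 1"
    using powr_less_mono[of "- 2 * s" 0 2] assms by simp
  then have geom: "summable (\<lambda>k. 2 ^ DIM('a) * U * (2 powr (- 2 * s)) ^ k)"
    by (intro summable_mult summable_geometric) simp
  have a_geom: "a = (\<lambda>k. 2 ^ DIM('a) * U * (2 powr (- 2 * s)) ^ k)"
    by (rule ext) (rule a_eq)
  have "summable a"
    by (rule ssubst[OF a_geom]) (rule geom)
  have "(\<integral>\<^sup>+x. ennreal (1 / tail_weight s (x::'a)) \<partial>lborel)
      \<le> (\<integral>\<^sup>+x. indicator (ball 0 1) x
          + (\<Sum>k. ennreal (2 powr (- real k * p)) * indicator (ball 0 (2 ^ Suc k)) x) \<partial>(lborel :: 'a measure))"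
  proof (rule nn_integral_mono)
    fix x :: 'a
    show "ennreal (1 / tail_weight s x) \<le> indicator (ball 0 1) x
          + (\<Sum>k. ennreal (2 powr (- real k * p)) * indicator (ball 0 (2 ^ Suc k)) x)"
    proof (cases "norm x < 1")
      case True
      then have "ennreal (1 / tail_weight s x) \<le> indicator (ball 0 1) x"
        using tail_weight_ge_1[of s x] by (simp add: indicator_def)
      then show ?thesis by (rule order_trans) simp
    next
      case False
      then obtain k :: nat where k: "2 ^ k \<le> norm x" "norm x < 2 ^ Suc k"
        using ex_dyadic_shell[of "norm x"] by auto
      have "2 powr (real k * p) \<le> norm x powr p"
        using powr_mono2[of p "2 ^ k" "norm x"] k assms
        by (simp add: p_def powr_powr flip: powr_realpow)
      also have "\<dots> \<le> tail_weight s x" by (simp add: tail_weight_def p_def)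
      finally have "1 / tail_weight s x \<le> 2 powr (- real k * p)"
        using tail_weight_pos[of s x] by (simp add: powr_minus field_simps)
      then have "ennreal (1 / tail_weight s x)
          \<le> ennreal (2 powr (- real k * p)) * indicator (ball 0 (2 ^ Suc k)) x"
        using k by (simp add: ennreal_leI)
      also have "\<dots> \<le> (\<Sum>k. ennreal (2 powr (- real k * p)) * indicator (ball 0 (2 ^ Suc k)) x)"
      proof -
        have "h k \<le> suminf h" for h :: "nat \<Rightarrow> ennreal"
          using sum_le_suminf[of h "{k}"] by simp
        then show ?thesis .
      qed
      finally show ?thesis by (rule order_trans) simp
    qed
  qed
  also have "\<dots> = emeasure lborel (ball (0::'a) 1)
      + (\<Sum>k. ennreal (2 powr (- real k * p)) * emeasure lborel (ball (0::'a) (2 ^ Suc k)))"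
  proof -
    have "(\<integral>\<^sup>+x. (\<Sum>k. ennreal (2 powr (- real k * p)) * indicator (ball (0::'a) (2 ^ Suc k)) x) \<partial>lborel)
        = (\<Sum>k. \<integral>\<^sup>+x. ennreal (2 powr (- real k * p)) * indicator (ball (0::'a) (2 ^ Suc k)) x \<partial>lborel)"
      by (rule nn_integral_suminf)
        (intro borel_measurable_times_ennreal borel_measurable_const borel_measurable_indicator, simp)
    also have "\<dots> = (\<Sum>k. ennreal (2 powr (- real k * p)) * emeasure lborel (ball (0::'a) (2 ^ Suc k)))"
      by (intro suminf_cong nn_integral_cmult_indicator) simp
    finally have series: "(\<integral>\<^sup>+x. (\<Sum>k. ennreal (2 powr (- real k * p)) * indicator (ball (0::'a) (2 ^ Suc k)) x) \<partial>lborel)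
        = (\<Sum>k. ennreal (2 powr (- real k * p)) * emeasure lborel (ball (0::'a) (2 ^ Suc k)))" .
    have ball1: "(\<integral>\<^sup>+x. indicator (ball (0::'a) 1) x \<partial>lborel) = emeasure lborel (ball (0::'a) 1)"
      by (intro nn_integral_indicator) simp
    show ?thesis
      unfolding series[symmetric] ball1[symmetric] by (rule nn_integral_add)
        (intro borel_measurable_suminf_order borel_measurable_times_ennreal
          borel_measurable_const borel_measurable_indicator, simp)+
  qed
  also have "(\<Sum>k. ennreal (2 powr (- real k * p)) * emeasure lborel (ball (0::'a) (2 ^ Suc k)))
      = (\<Sum>k. ennreal (a k))"
    by (simp add: ball a_def ennreal_mult[symmetric] U_def mult.assoc del: power_Suc)
  also have "\<dots> = ennreal (suminf a)"
    by (rule suminf_ennreal2[OF _ \<open>summable a\<close>]) (simp add: a_def U_def)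
  finally show ?thesis
    using emeasure_lborel_ball_finite[of "0::'a" 1] by (auto simp: top_unique less_top intro: le_less_trans)
qed

text \<open>
  This compares the singular kernel with the weight, uniformly for \<open>y\<close> in a bounded set; it holds
  since \<open>\<bar>x - y\<bar> \<le> \<bar>x\<bar> + R \<le> 2 * R * max 1 \<bar>x\<bar>\<close>.
\<close>

lemma norm_diff_powr_le_tail_weight:
  fixes x y :: "'a::euclidean_space"
  assumes "0 < s" "norm y \<le> R" "1 \<le> R"
  shows "norm (x - y) powr (real DIM('a) + 2 * s)
    \<le> (2 * R) powr (real DIM('a) + 2 * s) * tail_weight s x"
proof -
  let ?p = "real DIM('a) + 2 * s"
  have "norm (x - y) \<le> norm x + R" using norm_triangle_ineq4[of x y] assms by linarith
  also have "\<dots> \<le> 2 * R * max 1 (norm x)"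
  proof -
    have "norm x \<le> R * max 1 (norm x)" "R \<le> R * max 1 (norm x)"
      using assms mult_mono[of 1 R "norm x" "max 1 (norm x)"] by auto
    then show ?thesis by linarith
  qed
  finally have "norm (x - y) powr ?p \<le> (2 * R * max 1 (norm x)) powr ?p"
    using assms by (intro powr_mono2) auto
  also have "\<dots> = (2 * R) powr ?p * max 1 (norm x) powr ?p"
    using assms by (intro powr_mult) 
  also have "max 1 (norm x) powr ?p \<le> tail_weight s x"
    by (auto simp: tail_weight_def max_def)
  finally show ?thesis by (simp add: mult_left_mono)
qed

section \<open>The energy space\<close>

lemma frac_const_pos:
  assumes "0 < s" "s < 1"
  shows "0 < frac_const d s"
  using assms by (simp add: frac_const_def Gamma_real_pos)

text \<open>
  A square root of the kernel is split off so that the Gagliardo form becomes an \<open>L\<^sup>2\<close> product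
  of difference quotients. Cutting off to the region lets the integrals run over the whole space.
\<close>

definition difference_quotient ::
  "'a::euclidean_space set \<Rightarrow> real \<Rightarrow> ('a \<Rightarrow> real) \<Rightarrow> 'a \<times> 'a \<Rightarrow> real" where
  "difference_quotient \<Omega> s v z = indicator (X_region \<Omega>) z *
     ((v (fst z) - v (snd z)) / norm (fst z - snd z) powr ((real DIM('a) + 2 * s) / 2))"

lemma indicator_X_integrand:
  "indicator (X_region \<Omega>) z * X_integrand s u v z
    = difference_quotient \<Omega> s u z * difference_quotient \<Omega> s v z"
  by (cases z) (simp add: X_integrand_def difference_quotient_def indicator_def flip: powr_add)

lemma difference_quotient_lincomb:
  "difference_quotient \<Omega> s (\<lambda>x. u x + t * v x) z
    = difference_quotient \<Omega> s u z + t * difference_quotient \<Omega> s v z"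
  by (simp add: difference_quotient_def indicator_def diff_divide_distrib add_divide_distrib
      algebra_simps)

lemma X_region_borel [measurable]: "X_region \<Omega> \<in> sets borel"
proof -
  have "open (exterior \<Omega>)" by (simp add: exterior_def open_Compl)
  then have "open (exterior \<Omega> \<times> exterior \<Omega>)" by (intro open_Times)
  then show ?thesis by (simp add: X_region_def)
qed

lemma difference_quotient_measurable [measurable]:
  fixes v :: "'a::euclidean_space \<Rightarrow> real"
  assumes [measurable]: "v \<in> borel_measurable lebesgue"
  shows "difference_quotient \<Omega> s v \<in> borel_measurable lebesgue"
proof -
  have "(\<lambda>z :: 'a \<times> 'a. indicator (X_region \<Omega>) z / norm (fst z - snd z) powr ((real DIM('a) + 2 * s) / 2))
      \<in> borel_measurable (borel \<Otimes>\<^sub>M borel)"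
    using X_region_borel[of \<Omega>] unfolding borel_prod[symmetric] by measurable
  then have [measurable]: "(\<lambda>z :: 'a \<times> 'a. indicator (X_region \<Omega>) z / norm (fst z - snd z) powr ((real DIM('a) + 2 * s) / 2))
      \<in> borel_measurable lebesgue"
    by (intro measurable_completion) (simp add: borel_prod)
  have "(\<lambda>z. (v (fst z) - v (snd z)) * (indicator (X_region \<Omega>) z / norm (fst z - snd z) powr ((real DIM('a) + 2 * s) / 2)))
      \<in> borel_measurable lebesgue"
    by measurable
  also have "(\<lambda>z. (v (fst z) - v (snd z)) * (indicator (X_region \<Omega>) z / norm (fst z - snd z) powr ((real DIM('a) + 2 * s) / 2)))
    = difference_quotient \<Omega> s v"
    by (simp add: difference_quotient_def fun_eq_iff)
  finally show ?thesis .
qed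

definition energy_form :: "'a::euclidean_space set \<Rightarrow> real \<Rightarrow> real \<Rightarrow> ('a \<Rightarrow> real) \<Rightarrow> ('a \<Rightarrow> real) \<Rightarrow> real" where
  "energy_form \<Omega> s \<alpha> u v = X_inner \<Omega> s u v + \<alpha> * L2_inner \<Omega> u v"

lemma X_inner_eq:
  fixes \<Omega> :: "'a::euclidean_space set"
  shows "X_inner \<Omega> s u v = frac_const DIM('a) s / 2 *
    (\<integral>z. difference_quotient \<Omega> s u z * difference_quotient \<Omega> s v z \<partial>lebesgue)"
  by (simp add: X_inner_def set_lebesgue_integral_def indicator_X_integrand)

lemma L2_inner_eq:
  "L2_inner A u v = (\<integral>x. (indicator A x * u x) * (indicator A x * v x) \<partial>lebesgue)"
  unfolding L2_inner_def set_lebesgue_integral_def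
  by (intro Bochner_Integration.integral_cong) (auto simp: indicator_def)

lemma X_seminorm_sq_eq:
  fixes \<Omega> :: "'a::euclidean_space set"
  shows "X_seminorm_sq \<Omega> s v = ennreal (frac_const DIM('a) s / 2) *
    (\<integral>\<^sup>+z. ennreal ((difference_quotient \<Omega> s v z)\<^sup>2) \<partial>lebesgue)"
  unfolding X_seminorm_sq_def power2_eq_square indicator_X_integrand[symmetric]
  by (intro arg_cong2[where f="(*)"] nn_integral_cong) (auto simp: indicator_def)

lemma L2_norm_sq_eq:
  "L2_norm_sq A v = (\<integral>\<^sup>+x. ennreal ((indicator A x * v x)\<^sup>2) \<partial>lebesgue)"
  unfolding L2_norm_sq_def by (intro nn_integral_cong) (auto simp: indicator_def)

lemma V_space_iff:
  fixes \<Omega> :: "'a::euclidean_space set"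
  assumes "\<Omega> \<in> sets lebesgue" "0 < s" "s < 1"
  shows "v \<in> V_space \<Omega> s \<longleftrightarrow> v \<in> borel_measurable lebesgue \<and>
    square_integrable lebesgue (\<lambda>x. indicator \<Omega> x * v x) \<and>
    square_integrable lebesgue (difference_quotient \<Omega> s v)"
  using assms frac_const_pos[OF assms(2,3), of "DIM('a)"]
  by (auto simp: V_space_def V_norm_sq_def X_seminorm_sq_eq L2_norm_sq_eq square_integrable_def
      ennreal_mult_less_top)

text \<open>
  The constant in front of the Gagliardo integral depends on \<open>s\<close> and the type of \<open>\<Omega>\<close> alone; being a
  parameter, its name carries no type argument.
\<close>

locale nonlocal_Neumann =
  fixes \<Omega> :: "'a::euclidean_space set" and s \<alpha> \<kappa> :: real
  assumes open_\<Omega>: "open \<Omega>" and \<Omega>_ne: "\<Omega> \<noteq> {}" and bounded_\<Omega>: "bounded \<Omega>"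
    and s_pos: "0 < s" and s_less_1: "s < 1" and \<alpha>_pos: "0 < \<alpha>"
    and \<kappa>_eq: "\<kappa> = frac_const DIM('a) s / 2"
begin

abbreviation B :: "('a \<Rightarrow> real) \<Rightarrow> ('a \<Rightarrow> real) \<Rightarrow> real" where
  "B \<equiv> energy_form \<Omega> s \<alpha>"

lemma \<kappa>_pos: "0 < \<kappa>"
  using frac_const_pos[OF s_pos s_less_1] by (simp add: \<kappa>_eq)

lemma \<Omega>_lebesgue [measurable]: "\<Omega> \<in> sets lebesgue"
  using open_\<Omega> by simp

lemma \<Omega>_radius:
  obtains R where "1 \<le> R" "\<And>y. y \<in> \<Omega> \<Longrightarrow> norm y \<le> R"
proof -
  obtain r where "\<And>y. y \<in> \<Omega> \<Longrightarrow> norm y \<le> r"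
    using bounded_\<Omega> unfolding bounded_iff by blast
  then show thesis by (intro that[of "max 1 r"]) (auto simp: le_max_iff_disj)
qed

lemma V_space_measurable: "v \<in> V_space \<Omega> s \<Longrightarrow> v \<in> borel_measurable lebesgue"
  by (simp add: V_space_def)

lemma V_space_square_integrable:
  assumes "v \<in> V_space \<Omega> s"
  shows "square_integrable lebesgue (\<lambda>x. indicator \<Omega> x * v x)"
    "square_integrable lebesgue (difference_quotient \<Omega> s v)"
  using assms V_space_iff[OF \<Omega>_lebesgue s_pos s_less_1] by auto

lemma V_space_lincomb:
  assumes u: "u \<in> V_space \<Omega> s" and v: "v \<in> V_space \<Omega> s"
  shows "(\<lambda>x. u x + t * v x) \<in> V_space \<Omega> s"
proof -
  note sq = V_space_square_integrable
  have "square_integrable lebesgue (\<lambda>x. indicator \<Omega> x * u x + t * (indicator \<Omega> x * v x))"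
    by (intro square_integrable_lincomb sq u v)
  moreover have "square_integrable lebesgue
      (\<lambda>z. difference_quotient \<Omega> s u z + t * difference_quotient \<Omega> s v z)"
    by (intro square_integrable_lincomb sq u v)
  ultimately show ?thesis
    using V_space_measurable[OF u] V_space_measurable[OF v]
    by (simp add: V_space_iff s_pos s_less_1 difference_quotient_lincomb[abs_def] algebra_simps)
qed

lemma V_space_diff:
  assumes "u \<in> V_space \<Omega> s" "v \<in> V_space \<Omega> s"
  shows "(\<lambda>x. u x - v x) \<in> V_space \<Omega> s"
  using V_space_lincomb[OF assms, of "-1"] by simp

lemma zero_in_V_space: "(\<lambda>x. 0) \<in> V_space \<Omega> s"
  by (simp add: V_space_iff s_pos s_less_1 square_integrable_def difference_quotient_def[abs_def])

lemma energy_form_eq: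
  "B u v = \<kappa> * (\<integral>z. difference_quotient \<Omega> s u z * difference_quotient \<Omega> s v z \<partial>lebesgue)
    + \<alpha> * (\<integral>x. (indicator \<Omega> x * u x) * (indicator \<Omega> x * v x) \<partial>lebesgue)"
  by (simp add: energy_form_def X_inner_eq L2_inner_eq \<kappa>_eq)

lemma energy_form_sym: "B u v = B v u"
  by (simp add: energy_form_eq mult.commute)

lemma energy_form_lincomb:
  assumes u: "u \<in> V_space \<Omega> s" and v: "v \<in> V_space \<Omega> s" and w: "w \<in> V_space \<Omega> s"
  shows "B (\<lambda>x. u x + t * v x) w = B u w + t * B v w"
proof -
  let ?D = "difference_quotient \<Omega> s" and ?i = "indicator \<Omega> :: 'a \<Rightarrow> real"
  note sq = V_space_square_integrable
  have "(\<integral>z. ?D (\<lambda>x. u x + t * v x) z * ?D w z \<partial>lebesgue)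
      = (\<integral>z. ?D u z * ?D w z + t * (?D v z * ?D w z) \<partial>lebesgue)"
    by (simp add: difference_quotient_lincomb algebra_simps)
  also have "\<dots> = (\<integral>z. ?D u z * ?D w z \<partial>lebesgue) + t * (\<integral>z. ?D v z * ?D w z \<partial>lebesgue)"
    using square_integrable_mult[OF sq(2)[OF u] sq(2)[OF w]]
      square_integrable_mult[OF sq(2)[OF v] sq(2)[OF w]] by simp
  finally have 1: "(\<integral>z. ?D (\<lambda>x. u x + t * v x) z * ?D w z \<partial>lebesgue)
      = (\<integral>z. ?D u z * ?D w z \<partial>lebesgue) + t * (\<integral>z. ?D v z * ?D w z \<partial>lebesgue)" .
  have "(\<integral>x. (?i x * (u x + t * v x)) * (?i x * w x) \<partial>lebesgue)
      = (\<integral>x. (?i x * u x) * (?i x * w x) + t * ((?i x * v x) * (?i x * w x)) \<partial>lebesgue)"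
    by (simp add: algebra_simps)
  also have "\<dots> = (\<integral>x. (?i x * u x) * (?i x * w x) \<partial>lebesgue)
      + t * (\<integral>x. (?i x * v x) * (?i x * w x) \<partial>lebesgue)"
    using square_integrable_mult[OF sq(1)[OF u] sq(1)[OF w]]
      square_integrable_mult[OF sq(1)[OF v] sq(1)[OF w]] by simp
  finally have 2: "(\<integral>x. (?i x * (u x + t * v x)) * (?i x * w x) \<partial>lebesgue)
      = (\<integral>x. (?i x * u x) * (?i x * w x) \<partial>lebesgue)
      + t * (\<integral>x. (?i x * v x) * (?i x * w x) \<partial>lebesgue)" .
  show ?thesis
    unfolding energy_form_eq 1 2 by (simp add: algebra_simps)
qed

text \<open>
  On the energy space the real-valued form and the extended nonnegative integrals agree, so
  that estimates can be proved where integrals need no convergence argument.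
\<close>

lemma energy_form_split:
  assumes "v \<in> V_space \<Omega> s"
  obtains a b where "0 \<le> a" "0 \<le> b" "B v v = \<kappa> * b + \<alpha> * a"
    "(\<integral>\<^sup>+x. ennreal ((indicator \<Omega> x * v x)\<^sup>2) \<partial>lebesgue) = ennreal a"
    "(\<integral>\<^sup>+z. ennreal ((difference_quotient \<Omega> s v z)\<^sup>2) \<partial>lebesgue) = ennreal b"
proof
  show "B v v = \<kappa> * (\<integral>z. difference_quotient \<Omega> s v z * difference_quotient \<Omega> s v z \<partial>lebesgue)
    + \<alpha> * (\<integral>x. (indicator \<Omega> x * v x) * (indicator \<Omega> x * v x) \<partial>lebesgue)"
    by (rule energy_form_eq)
qed (use square_integrable_integral_sq[OF V_space_square_integrable(1)[OF assms]]
      square_integrable_integral_sq[OF V_space_square_integrable(2)[OF assms]] in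
      \<open>auto intro!: integral_nonneg_AE\<close>)

lemma energy_form_nonneg: "v \<in> V_space \<Omega> s \<Longrightarrow> 0 \<le> B v v"
  using \<kappa>_pos \<alpha>_pos by (elim energy_form_split) simp

section \<open>Control of the weighted norm by the energy\<close>

text \<open>
  For \<open>y \<in> \<Omega>\<close> the pair \<open>(x, y)\<close> lies in the region of integration whatever \<open>x\<close> is. Integrating
  \<open>(v x)\<^sup>2 \<le> 2 (v y)\<^sup>2 + 2 (v x - v y)\<^sup>2\<close>, divided by the weight at \<open>x\<close>,
  over all \<open>x\<close> and over \<open>y \<in> \<Omega>\<close> gives the measure \<open>\<omega>\<close> of \<open>\<Omega>\<close> times the left-hand side. On the right the
  first term factors into the integral of the inverse weight and the \<open>L\<^sup>2(\<Omega>)\<close> norm, and the second is dominated by the Gagliardo integral.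
\<close>

lemma weighted_L2_le_energy:
  "\<exists>K>0. \<forall>v\<in>V_space \<Omega> s.
     (\<integral>\<^sup>+x. ennreal ((v x)\<^sup>2 / tail_weight s x) \<partial>lebesgue) \<le> ennreal (K * B v v)"
proof -
  let ?D = "difference_quotient \<Omega> s" and ?W = "tail_weight s :: 'a \<Rightarrow> real"
  obtain R where R: "1 \<le> R" "\<And>y. y \<in> \<Omega> \<Longrightarrow> norm y \<le> R"
    using \<Omega>_radius by blast
  define c where "c = (2 * R) powr (real DIM('a) + 2 * s)"
  have "c > 0" using R by (simp add: c_def)
  define I where "I = enn2real (\<integral>\<^sup>+x. ennreal (1 / ?W x) \<partial>lebesgue)"
  have I: "(\<integral>\<^sup>+x. ennreal (1 / ?W x) \<partial>lebesgue) = ennreal I" "0 \<le> I"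
    using integral_inverse_tail_weight_finite[OF s_pos, where 'a='a]
    by (simp_all add: I_def nn_integral_completion)
  have "emeasure lborel \<Omega> \<noteq> 0"
    using open_not_negligible[OF open_\<Omega> \<Omega>_ne] open_\<Omega>
    by (auto simp: negligible_iff_null_sets null_sets_def)
  moreover have "emeasure lborel \<Omega> < \<infinity>"
    using bounded_\<Omega> by (rule emeasure_bounded_finite)
  ultimately obtain \<omega> where \<omega>: "emeasure lebesgue \<Omega> = ennreal \<omega>" "\<omega> > 0"
    using open_\<Omega> by (cases "emeasure lborel \<Omega>") (auto simp: less_top)
  define K where "K = 2 * I / (\<omega> * \<alpha>) + 2 * c / (\<omega> * \<kappa>)"
  have "K > 0"
    unfolding K_def using I \<omega> \<open>c > 0\<close> \<kappa>_pos \<alpha>_pos by (intro add_nonneg_pos divide_nonneg_pos divide_pos_pos) auto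
  moreover have "(\<integral>\<^sup>+x. ennreal ((v x)\<^sup>2 / ?W x) \<partial>lebesgue) \<le> ennreal (K * B v v)"
    if v: "v \<in> V_space \<Omega> s" for v
  proof -
    have [measurable]: "v \<in> borel_measurable lebesgue" using v by (rule V_space_measurable)
    obtain a b where ab: "0 \<le> a" "0 \<le> b" "B v v = \<kappa> * b + \<alpha> * a"
      and a: "(\<integral>\<^sup>+x. ennreal ((indicator \<Omega> x * v x)\<^sup>2) \<partial>lebesgue) = ennreal a"
      and b: "(\<integral>\<^sup>+z. ennreal ((?D v z)\<^sup>2) \<partial>lebesgue) = ennreal b"
      using v by (rule energy_form_split)
    have pointwise: "(v x)\<^sup>2 / ?W x * indicator \<Omega> y
        \<le> 2 * (1 / ?W x * (indicator \<Omega> y * v y)\<^sup>2) + 2 * c * (?D v (x, y))\<^sup>2" for x y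
    proof (cases "y \<in> \<Omega>")
      case False
      then show ?thesis using \<open>c > 0\<close> by simp
    next
      case True
      let ?N = "norm (x - y) powr (real DIM('a) + 2 * s)"
      have "y \<notin> exterior \<Omega>" using True closure_subset by (auto simp: exterior_def)
      then have reg: "(x, y) \<in> X_region \<Omega>" by (simp add: X_region_def)
      have D: "(?D v (x, y))\<^sup>2 = (v x - v y)\<^sup>2 / ?N"
        using reg by (simp add: difference_quotient_def power_divide)
          (simp add: power2_eq_square flip: powr_add)
      \<comment> \<open>On the diagonal the kernel has value 0, but so has the difference.\<close>
      have "(v x - v y)\<^sup>2 / ?W x \<le> c * ((v x - v y)\<^sup>2 / ?N)"
      proof (cases "x = y")
        case False
        then have "?N > 0" by simp
        moreover have "?N \<le> c * ?W x"
          unfolding c_def using norm_diff_powr_le_tail_weight[OF s_pos R(2)[OF True] R(1)] .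
        ultimately have "1 / ?W x \<le> c / ?N"
          using tail_weight_pos[of s x] by (simp add: field_simps)
        then show ?thesis
          using mult_left_mono[of "1 / ?W x" "c / ?N" "(v x - v y)\<^sup>2"] by (simp add: mult.commute)
      qed simp
      moreover have "(v x)\<^sup>2 / ?W x \<le> 2 * ((v y)\<^sup>2 / ?W x) + 2 * ((v x - v y)\<^sup>2 / ?W x)"
      proof -
        have "0 \<le> (v x - 2 * v y)\<^sup>2" by simp
        then have "(v x)\<^sup>2 \<le> 2 * (v y)\<^sup>2 + 2 * (v x - v y)\<^sup>2"
          by (simp add: power2_eq_square algebra_simps)
        then show ?thesis
          using tail_weight_pos[of s x] by (simp add: field_simps)
      qed
      ultimately show ?thesis using True by (simp add: D)
    qed
    have "(\<integral>\<^sup>+x. ennreal ((v x)\<^sup>2 / ?W x) \<partial>lebesgue) * ennreal \<omega>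
        = (\<integral>\<^sup>+z. ennreal ((v (fst z))\<^sup>2 / ?W (fst z)) * indicator \<Omega> (snd z) \<partial>lebesgue)"
      by (subst nn_integral_lebesgue_pair_mult) (auto simp: \<omega>)
    also have "\<dots> \<le> (\<integral>\<^sup>+z. 2 * (ennreal (1 / ?W (fst z)) * ennreal ((indicator \<Omega> (snd z) * v (snd z))\<^sup>2))
        + ennreal (2 * c) * ennreal ((?D v z)\<^sup>2) \<partial>lebesgue)"
    proof (rule nn_integral_mono)
      fix z :: "'a \<times> 'a"
      obtain x y where z: "z = (x, y)" by (cases z)
      have "ennreal ((v x)\<^sup>2 / ?W x) * indicator \<Omega> y = ennreal ((v x)\<^sup>2 / ?W x * indicator \<Omega> y)"
        by (simp add: indicator_def)
      also have "\<dots> \<le> ennreal (2 * (1 / ?W x * (indicator \<Omega> y * v y)\<^sup>2) + 2 * c * (?D v (x, y))\<^sup>2)"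
        by (intro ennreal_leI pointwise)
      also have "\<dots> = 2 * (ennreal (1 / ?W x) * ennreal ((indicator \<Omega> y * v y)\<^sup>2))
        + ennreal (2 * c) * ennreal ((?D v (x, y))\<^sup>2)"
      proof -
        have "ennreal (2 * (p * q) + r * t) = 2 * (ennreal p * ennreal q) + ennreal r * ennreal t"
          if "0 \<le> p" "0 \<le> q" "0 \<le> r" "0 \<le> t" for p q r t
          using that by (simp add: ennreal_plus ennreal_mult)
        then show ?thesis
          using \<open>c > 0\<close> tail_weight_pos[of s x] by (meson less_imp_le mult_nonneg_nonneg zero_le_numeral zero_le_power2 zero_le_divide_1_iff)
      qed
      finally show "ennreal ((v (fst z))\<^sup>2 / ?W (fst z)) * indicator \<Omega> (snd z)
        \<le> 2 * (ennreal (1 / ?W (fst z)) * ennreal ((indicator \<Omega> (snd z) * v (snd z))\<^sup>2))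
        + ennreal (2 * c) * ennreal ((?D v z)\<^sup>2)" by (simp add: z)
    qed
    also have "\<dots> = 2 * (ennreal I * ennreal a) + ennreal (2 * c) * ennreal b"
      using nn_integral_lebesgue_pair_mult[of "\<lambda>x. ennreal (1 / ?W x)" "\<lambda>y. ennreal ((indicator \<Omega> y * v y)\<^sup>2)"]
      by (simp add: nn_integral_add nn_integral_cmult I a b del: ennreal_power)
    also have "\<dots> = ennreal (2 * I * a + 2 * c * b)"
      using I ab \<open>c > 0\<close> by (simp add: ennreal_plus ennreal_mult mult.assoc)
    finally have *: "(\<integral>\<^sup>+x. ennreal ((v x)\<^sup>2 / ?W x) \<partial>lebesgue) * ennreal \<omega> \<le> ennreal (2 * I * a + 2 * c * b)" .
    have "(\<integral>\<^sup>+x. ennreal ((v x)\<^sup>2 / ?W x) \<partial>lebesgue)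
        = (\<integral>\<^sup>+x. ennreal ((v x)\<^sup>2 / ?W x) \<partial>lebesgue) * ennreal \<omega> * ennreal (1 / \<omega>)"
      using \<omega> by (simp add: mult.assoc flip: ennreal_mult)
    also have "\<dots> \<le> ennreal (2 * I * a + 2 * c * b) * ennreal (1 / \<omega>)"
      using * by (rule mult_right_mono) simp
    also have "\<dots> = ennreal ((2 * I * a + 2 * c * b) / \<omega>)"
      using I ab \<open>c > 0\<close> \<omega> ennreal_mult[of "2 * I * a + 2 * c * b" "1 / \<omega>"]
      by simp
    also have "\<dots> \<le> ennreal (K * B v v)"
    proof (rule ennreal_leI)
      have "(2 * I * a + 2 * c * b) / \<omega> = 2 * I / (\<omega> * \<alpha>) * (\<alpha> * a) + 2 * c / (\<omega> * \<kappa>) * (\<kappa> * b)"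
        using \<omega> \<kappa>_pos \<alpha>_pos by (simp add: add_divide_distrib)
      also have "\<dots> \<le> K * (\<alpha> * a) + K * (\<kappa> * b)"
        using I ab \<omega> \<open>c > 0\<close> \<kappa>_pos \<alpha>_pos
        by (intro add_mono mult_right_mono) (auto simp: K_def)
      finally show "(2 * I * a + 2 * c * b) / \<omega> \<le> K * B v v"
        by (simp add: ab algebra_simps)
    qed
    finally show ?thesis .
  qed
  ultimately show ?thesis by blast
qed

end

section \<open>Completeness\<close>

text \<open>
  Each increment is bounded by a multiple of \<open>2\<^bsup>-k/2\<^esup>\<close>, so the increments are absolutely summable. The
  factor \<open>2 ^ k\<close> is affordable because the squared increments of the sequences in question
  have weighted integrals of order \<open>4\<^bsup>-k\<^esup>\<close>.
\<close>

lemma convergent_of_weighted_square_sum: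
  fixes X :: "nat \<Rightarrow> real" and W :: real
  assumes "0 < W" and fin: "(\<Sum>k. ennreal (2 ^ k * ((X (Suc k) - X k)\<^sup>2 / W))) < \<infinity>"
  shows "convergent X"
proof -
  define S where "S = enn2real (\<Sum>k. ennreal (2 ^ k * ((X (Suc k) - X k)\<^sup>2 / W)))"
  have S: "(\<Sum>k. ennreal (2 ^ k * ((X (Suc k) - X k)\<^sup>2 / W))) = ennreal S"
    using fin by (simp add: S_def)
  have bound: "\<bar>X (Suc k) - X k\<bar> \<le> sqrt (S * W) * (1 / sqrt 2) ^ k" for k
  proof -
    have "h k \<le> suminf h" for h :: "nat \<Rightarrow> ennreal"
      using sum_le_suminf[of h "{k}"] by simp
    then have "ennreal (2 ^ k * ((X (Suc k) - X k)\<^sup>2 / W)) \<le> ennreal S"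
      unfolding S[symmetric] .
    then have "2 ^ k * ((X (Suc k) - X k)\<^sup>2 / W) \<le> S"
      by (simp add: S_def)
    then have "(X (Suc k) - X k)\<^sup>2 \<le> S * W * (1 / 2) ^ k"
      using \<open>0 < W\<close> by (simp add: field_simps power_one_over)
    then have "sqrt ((X (Suc k) - X k)\<^sup>2) \<le> sqrt (S * W * (1 / 2) ^ k)"
      by (rule real_sqrt_le_mono)
    also have "\<dots> = sqrt (S * W) * (1 / sqrt 2) ^ k"
      by (simp add: real_sqrt_mult real_sqrt_power real_sqrt_divide)
    finally show ?thesis by simp
  qed
  have "summable (\<lambda>k. sqrt (S * W) * (1 / sqrt 2) ^ k)"
    by (intro summable_mult summable_geometric) simp
  then have "summable (\<lambda>k. X (Suc k) - X k)"
    by (rule summable_comparison_test') (use bound in auto)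
  then have "convergent (\<lambda>n. (\<Sum>k<n. X (Suc k) - X k))"
    by (simp add: summable_iff_convergent)
  then have "convergent (\<lambda>n. (X n - X 0) + X 0)"
    unfolding sum_lessThan_telescope by (intro convergent_add convergent_const)
  then show ?thesis by simp
qed

context nonlocal_Neumann
begin

text \<open>
  The weighted bound gives an almost everywhere limit \<open>u\<close> on the whole space. For fixed
  \<open>n\<close>, Fatou's lemma applied to \<open>X m - X n\<close> as \<open>m \<rightarrow> \<infinity>\<close>, separately for the \<open>L\<^sup>2(\<Omega>)\<close> part and the
  Gagliardo part, bounds the energy of \<open>u - X n\<close>; this also puts \<open>u\<close> into the space.
\<close>

lemma V_space_complete:
  fixes X :: "nat \<Rightarrow> 'a \<Rightarrow> real"
  assumes X: "\<And>n. X n \<in> V_space \<Omega> s"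
    and Cauchy: "\<And>m n. n \<le> m \<Longrightarrow> B (\<lambda>x. X m x - X n x) (\<lambda>x. X m x - X n x) \<le> (1/4) ^ n"
  shows "\<exists>u\<in>V_space \<Omega> s. (\<lambda>n. B (\<lambda>x. u x - X n x) (\<lambda>x. u x - X n x)) \<longlonglongrightarrow> 0"
proof -
  let ?D = "difference_quotient \<Omega> s" and ?W = "tail_weight s :: 'a \<Rightarrow> real"
  have [measurable]: "X n \<in> borel_measurable lebesgue" for n
    using X by (rule V_space_measurable)
  obtain K where "K > 0" and K: "\<And>v. v \<in> V_space \<Omega> s \<Longrightarrow>
      (\<integral>\<^sup>+x. ennreal ((v x)\<^sup>2 / ?W x) \<partial>lebesgue) \<le> ennreal (K * B v v)"
    using weighted_L2_le_energy by blast
  let ?f = "\<lambda>k x. ennreal (2 ^ k * ((X (Suc k) x - X k x)\<^sup>2 / ?W x))"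
  have "(\<integral>\<^sup>+x. (\<Sum>k. ?f k x) \<partial>lebesgue) = (\<Sum>k. \<integral>\<^sup>+x. ?f k x \<partial>lebesgue)"
    by (rule nn_integral_suminf) measurable
  also have "\<dots> \<le> (\<Sum>k. ennreal (K * (1/2) ^ k))"
  proof (rule suminf_le)
    fix k
    have "(\<integral>\<^sup>+x. ?f k x \<partial>lebesgue)
        = (\<integral>\<^sup>+x. ennreal (2 ^ k) * ennreal ((X (Suc k) x - X k x)\<^sup>2 / ?W x) \<partial>lebesgue)"
      by (intro nn_integral_cong ennreal_mult') simp
    also have "\<dots> = ennreal (2 ^ k) * (\<integral>\<^sup>+x. ennreal ((X (Suc k) x - X k x)\<^sup>2 / ?W x) \<partial>lebesgue)"
      by (rule nn_integral_cmult) measurable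
    also have "\<dots> \<le> ennreal (2 ^ k) * ennreal (K * (1/4) ^ k)"
    proof (rule mult_left_mono)
      have "(\<integral>\<^sup>+x. ennreal ((X (Suc k) x - X k x)\<^sup>2 / ?W x) \<partial>lebesgue)
          \<le> ennreal (K * B (\<lambda>x. X (Suc k) x - X k x) (\<lambda>x. X (Suc k) x - X k x))"
        by (rule K) (intro V_space_diff X)
      also have "\<dots> \<le> ennreal (K * (1/4) ^ k)"
        using \<open>K > 0\<close> Cauchy[of k "Suc k"] by (intro ennreal_leI mult_left_mono) auto
      finally show "(\<integral>\<^sup>+x. ennreal ((X (Suc k) x - X k x)\<^sup>2 / ?W x) \<partial>lebesgue)
          \<le> ennreal (K * (1/4) ^ k)" .
    qed simp
    also have "\<dots> = ennreal (K * (2 * (1/4)) ^ k)"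
      using \<open>K > 0\<close> unfolding power_mult_distrib
      by (simp add: mult.left_commute flip: ennreal_mult del: ennreal_power)
    finally show "(\<integral>\<^sup>+x. ?f k x \<partial>lebesgue) \<le> ennreal (K * (1/2) ^ k)" by simp
  qed auto
  also have "\<dots> = ennreal (\<Sum>k. K * (1/2) ^ k)"
    using \<open>K > 0\<close> by (intro suminf_ennreal2 summable_mult summable_geometric) auto
  finally have "(\<integral>\<^sup>+x. (\<Sum>k. ?f k x) \<partial>lebesgue) < \<infinity>"
    by (simp add: le_less_trans)
  then have "AE x in lebesgue. (\<Sum>k. ?f k x) \<noteq> \<infinity>"
    by (intro nn_integral_noteq_infinite) auto
  then have "AE x in lebesgue. convergent (\<lambda>n. X n x)"
  proof eventually_elim
    case (elim x)
    show ?case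
      by (rule convergent_of_weighted_square_sum[of "?W x"])
        (use elim tail_weight_pos[of s x] in \<open>auto simp: less_top\<close>)
  qed
  moreover define u where "u x = lim (\<lambda>n. X n x)" for x
  ultimately have lim: "AE x in lebesgue. (\<lambda>n. X n x) \<longlonglongrightarrow> u x"
    by (simp add: convergent_LIMSEQ_iff)
  have [measurable]: "u \<in> borel_measurable lebesgue"
    unfolding u_def[abs_def] by measurable
  have L2_bound: "(\<integral>\<^sup>+x. ennreal ((indicator \<Omega> x * (u x - X n x))\<^sup>2) \<partial>lebesgue) \<le> ennreal ((1/4) ^ n / \<alpha>)"
    and X_bound: "(\<integral>\<^sup>+z. ennreal ((?D (\<lambda>x. u x - X n x) z)\<^sup>2) \<partial>lebesgue) \<le> ennreal ((1/4) ^ n / \<kappa>)" for n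
  proof -
    have split: "(\<integral>\<^sup>+x. ennreal ((indicator \<Omega> x * (X m x - X n x))\<^sup>2) \<partial>lebesgue) \<le> ennreal ((1/4) ^ n / \<alpha>) \<and>
      (\<integral>\<^sup>+z. ennreal ((?D (\<lambda>x. X m x - X n x) z)\<^sup>2) \<partial>lebesgue) \<le> ennreal ((1/4) ^ n / \<kappa>)" if "n \<le> m" for m
    proof -
      obtain a b where ab: "0 \<le> a" "0 \<le> b"
        "B (\<lambda>x. X m x - X n x) (\<lambda>x. X m x - X n x) = \<kappa> * b + \<alpha> * a"
        "(\<integral>\<^sup>+x. ennreal ((indicator \<Omega> x * (X m x - X n x))\<^sup>2) \<partial>lebesgue) = ennreal a"
        "(\<integral>\<^sup>+z. ennreal ((?D (\<lambda>x. X m x - X n x) z)\<^sup>2) \<partial>lebesgue) = ennreal b"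
        using V_space_diff[OF X X] by (rule energy_form_split)
      have "\<kappa> * b + \<alpha> * a \<le> (1/4) ^ n" using Cauchy[OF that] ab by simp
      moreover have "0 \<le> \<kappa> * b" "0 \<le> \<alpha> * a" using ab \<kappa>_pos \<alpha>_pos by auto
      ultimately have "\<alpha> * a \<le> (1/4) ^ n" "\<kappa> * b \<le> (1/4) ^ n" by linarith+
      then show ?thesis
        using ab \<kappa>_pos \<alpha>_pos by (auto intro!: ennreal_leI simp: pos_le_divide_eq mult.commute)
    qed
    show "(\<integral>\<^sup>+x. ennreal ((indicator \<Omega> x * (u x - X n x))\<^sup>2) \<partial>lebesgue) \<le> ennreal ((1/4) ^ n / \<alpha>)"
    proof (rule Fatou_square[where \<phi> = "\<lambda>m x. indicator \<Omega> x * (X m x - X n x)"])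
      show "AE x in lebesgue. (\<lambda>m. indicator \<Omega> x * (X m x - X n x)) \<longlonglongrightarrow> indicator \<Omega> x * (u x - X n x)"
        using lim by eventually_elim (intro tendsto_intros)
    qed (use split in auto)
    show "(\<integral>\<^sup>+z. ennreal ((?D (\<lambda>x. u x - X n x) z)\<^sup>2) \<partial>lebesgue) \<le> ennreal ((1/4) ^ n / \<kappa>)"
    proof (rule Fatou_square[where \<phi> = "\<lambda>m. ?D (\<lambda>x. X m x - X n x)"])
      show "AE z in lebesgue. (\<lambda>m. ?D (\<lambda>x. X m x - X n x) z) \<longlonglongrightarrow> ?D (\<lambda>x. u x - X n x) z"
        using AE_lebesgue_pair[OF lim]
      proof eventually_elim
        case (elim z)
        have "(\<lambda>m. indicator (X_region \<Omega>) z *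
            (((X m (fst z) - X n (fst z)) - (X m (snd z) - X n (snd z)))
              * inverse (norm (fst z - snd z) powr ((real DIM('a) + 2 * s) / 2))))
          \<longlonglongrightarrow> indicator (X_region \<Omega>) z *
            (((u (fst z) - X n (fst z)) - (u (snd z) - X n (snd z)))
              * inverse (norm (fst z - snd z) powr ((real DIM('a) + 2 * s) / 2)))"
          using elim by (intro tendsto_mult tendsto_diff tendsto_const) auto
        then show ?case by (simp only: difference_quotient_def divide_inverse)
      qed
    qed (use split in auto)
  qed
  have diff: "(\<lambda>x. u x - X n x) \<in> V_space \<Omega> s" for n
    using le_less_trans[OF L2_bound[of n]] le_less_trans[OF X_bound[of n]]
    by (simp add: V_space_iff s_pos s_less_1 square_integrable_def)
  have u: "u \<in> V_space \<Omega> s"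
    using V_space_lincomb[OF diff[of 0] X[of 0], of 1] by simp
  have bound: "B (\<lambda>x. u x - X n x) (\<lambda>x. u x - X n x) \<le> 2 * (1/4) ^ n" for n
  proof -
    obtain a b where ab: "0 \<le> a" "0 \<le> b"
      "B (\<lambda>x. u x - X n x) (\<lambda>x. u x - X n x) = \<kappa> * b + \<alpha> * a"
      "(\<integral>\<^sup>+x. ennreal ((indicator \<Omega> x * (u x - X n x))\<^sup>2) \<partial>lebesgue) = ennreal a"
      "(\<integral>\<^sup>+z. ennreal ((?D (\<lambda>x. u x - X n x) z)\<^sup>2) \<partial>lebesgue) = ennreal b"
      using diff by (rule energy_form_split)
    have "a \<le> (1/4) ^ n / \<alpha>" "b \<le> (1/4) ^ n / \<kappa>"
      using L2_bound[of n] X_bound[of n] \<kappa>_pos \<alpha>_pos by (simp_all add: ab)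
    then have "\<alpha> * a \<le> (1/4) ^ n" "\<kappa> * b \<le> (1/4) ^ n"
      using \<kappa>_pos \<alpha>_pos by (simp_all add: pos_le_divide_eq mult.commute)
    then show ?thesis by (simp add: ab)
  qed
  have "(\<lambda>n. B (\<lambda>x. u x - X n x) (\<lambda>x. u x - X n x)) \<longlonglongrightarrow> 0"
  proof (rule tendsto_sandwich[of "\<lambda>_. 0"])
    show "(\<lambda>n. 2 * (1/4 :: real) ^ n) \<longlonglongrightarrow> 0"
      by (intro tendsto_mult_right_zero LIMSEQ_power_zero) simp
  qed (use bound energy_form_nonneg[OF diff] in auto)
  with u show ?thesis by blast
qed

section \<open>The load functional and uniqueness\<close>

lemma weighted_L2_V_space:
  assumes "v \<in> V_space \<Omega> s"
  shows "square_integrable lebesgue (\<lambda>x. v x / sqrt (tail_weight s x))"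
proof -
  have [measurable]: "v \<in> borel_measurable lebesgue"
    using assms by (rule V_space_measurable)
  obtain K where "(\<integral>\<^sup>+x. ennreal ((v x)\<^sup>2 / tail_weight s x) \<partial>lebesgue) \<le> ennreal (K * B v v)"
    using weighted_L2_le_energy assms by blast
  also have "ennreal (K * B v v) < \<infinity>" by simp
  finally show ?thesis
    by (simp add: square_integrable_def power_divide tail_weight_pos less_imp_le)
qed

lemma dual_L2s_square_integrable:
  assumes "h \<in> dual_L2s_space A s" 
  shows "square_integrable lebesgue (\<lambda>x :: 'a. indicator A x * h x * sqrt (tail_weight s x))"
proof -
  have [measurable]: "(\<lambda>x. indicator A x * h x) \<in> borel_measurable lebesgue"
    using assms by (simp add: dual_L2s_space_def set_borel_measurable_def)
  have "(\<integral>\<^sup>+x. ennreal ((indicator A x * h x * sqrt (tail_weight s x))\<^sup>2) \<partial>lebesgue)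
      = (\<integral>\<^sup>+x\<in>A. ennreal ((h x)\<^sup>2 * tail_weight s x) \<partial>lebesgue)"
    by (intro nn_integral_cong)
      (auto simp: indicator_def power_mult_distrib tail_weight_pos less_imp_le)
  also have "\<dots> < \<infinity>"
    using assms by (simp add: dual_L2s_space_def tail_weight_def)
  finally show ?thesis
    by (simp add: square_integrable_def)
qed

text \<open>
  Inserting the weight and its inverse exhibits the pairing as an \<open>L\<^sup>2\<close> product of two square
  integrable functions on the whole space.
\<close>

lemma L2_inner_weighted:
  fixes v :: "'a \<Rightarrow> real"
  shows
  "L2_inner A h v = (\<integral>x. (indicator A x * h x * sqrt (tail_weight s x)) *
      (v x / sqrt (tail_weight s x)) \<partial>lebesgue)"
  unfolding L2_inner_def set_lebesgue_integral_def
  using tail_weight_pos[of s] by (intro Bochner_Integration.integral_cong) (auto simp: less_le)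

lemma L2_inner_dual_lincomb:
  assumes h: "h \<in> dual_L2s_space A s" and u: "u \<in> V_space \<Omega> s" and v: "v \<in> V_space \<Omega> s"
  shows "L2_inner A h (\<lambda>x. u x + t * v x) = L2_inner A h u + t * L2_inner A h v"
proof -
  let ?h = "\<lambda>x. indicator A x * h x * sqrt (tail_weight s x)" and ?W = "\<lambda>x :: 'a. sqrt (tail_weight s x)"
  have "L2_inner A h (\<lambda>x. u x + t * v x)
      = (\<integral>x. ?h x * (u x / ?W x) + t * (?h x * (v x / ?W x)) \<partial>lebesgue)"
    unfolding L2_inner_weighted
    by (intro Bochner_Integration.integral_cong) (simp_all add: add_divide_distrib algebra_simps)
  also have "\<dots> = L2_inner A h u + t * L2_inner A h v"
    unfolding L2_inner_weighted
    using square_integrable_mult[OF dual_L2s_square_integrable[OF h] weighted_L2_V_space[OF u]]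
      square_integrable_mult[OF dual_L2s_square_integrable[OF h] weighted_L2_V_space[OF v]]
    by simp
  finally show ?thesis .
qed

lemma L2_inner_dual_bound:
  assumes h: "h \<in> dual_L2s_space A s" and "\<epsilon> > 0"
  shows "\<exists>C. \<forall>v\<in>V_space \<Omega> s. 2 * L2_inner A h v \<le> C + \<epsilon> * B v v"
proof -
  let ?h = "\<lambda>x. indicator A x * h x * sqrt (tail_weight s x)" and ?W = "\<lambda>x :: 'a. sqrt (tail_weight s x)"
  obtain K where "K > 0" and K: "\<And>v. v \<in> V_space \<Omega> s \<Longrightarrow>
      (\<integral>\<^sup>+x. ennreal ((v x)\<^sup>2 / tail_weight s x) \<partial>lebesgue) \<le> ennreal (K * B v v)"
    using weighted_L2_le_energy by blast
  define \<delta> where "\<delta> = \<epsilon> / K"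
  have "\<delta> > 0" using \<open>K > 0\<close> \<open>\<epsilon> > 0\<close> by (simp add: \<delta>_def)
  have "2 * L2_inner A h v \<le> (\<integral>x. ?h x * ?h x \<partial>lebesgue) / \<delta> + \<epsilon> * B v v"
    if v: "v \<in> V_space \<Omega> s" for v
  proof -
    note sq = weighted_L2_V_space[OF v]
    have "ennreal (\<integral>x. (v x / ?W x) * (v x / ?W x) \<partial>lebesgue) \<le> ennreal (K * B v v)"
      unfolding square_integrable_integral_sq[OF sq]
      using K[OF v] by (simp add: power_divide tail_weight_pos less_imp_le)
    then have "(\<integral>x. (v x / ?W x) * (v x / ?W x) \<partial>lebesgue) \<le> K * B v v"
      using \<open>K > 0\<close> energy_form_nonneg[OF v] by (simp add: ennreal_le_iff)
    then have "\<delta> * (\<integral>x. (v x / ?W x) * (v x / ?W x) \<partial>lebesgue) \<le> \<delta> * (K * B v v)"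
      using \<open>\<delta> > 0\<close> by (intro mult_left_mono) auto
    also have "\<delta> * (K * B v v) = \<epsilon> * B v v" using \<open>K > 0\<close> by (simp add: \<delta>_def)
    finally show ?thesis
      using square_integrable_Young[OF dual_L2s_square_integrable[OF h] sq \<open>\<delta> > 0\<close>]
      by (simp only: L2_inner_weighted)
  qed
  then show ?thesis by blast
qed

text \<open>
  The weight is bounded on \<open>\<Omega>\<close>, so the interior load obeys the same estimates as the exterior one.
\<close>

lemma L2_space_subset_dual: "L2_space \<Omega> \<subseteq> dual_L2s_space \<Omega> s"
proof
  fix f assume f: "f \<in> L2_space \<Omega>"
  have meas: "(\<lambda>x. indicator \<Omega> x * f x) \<in> borel_measurable lebesgue"
    using f by (simp add: L2_space_def set_borel_measurable_def)
  obtain R where R: "1 \<le> R" "\<And>y. y \<in> \<Omega> \<Longrightarrow> norm y \<le> R"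
    using \<Omega>_radius by blast
  define c where "c = 1 + R powr (real DIM('a) + 2 * s)"
  have "0 \<le> c" by (simp add: c_def)
  have "(\<integral>\<^sup>+x\<in>\<Omega>. ennreal ((f x)\<^sup>2 * (1 + norm x powr (real DIM('a) + 2 * s))) \<partial>lebesgue)
      \<le> (\<integral>\<^sup>+x. ennreal c * ennreal ((indicator \<Omega> x * f x)\<^sup>2) \<partial>lebesgue)"
  proof (rule nn_integral_mono)
    fix x
    have "(f x)\<^sup>2 * (1 + norm x powr (real DIM('a) + 2 * s)) \<le> c * (f x)\<^sup>2" if "x \<in> \<Omega>"
      using powr_mono2[of "real DIM('a) + 2 * s" "norm x" R] R(2)[OF that] s_pos
      by (subst mult.commute) (intro mult_right_mono, auto simp: c_def)
    then show "ennreal ((f x)\<^sup>2 * (1 + norm x powr (real DIM('a) + 2 * s))) * indicator \<Omega> x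
        \<le> ennreal c * ennreal ((indicator \<Omega> x * f x)\<^sup>2)"
      using \<open>0 \<le> c\<close>
      by (auto simp: indicator_def ennreal_mult[symmetric] simp del: ennreal_power intro!: ennreal_leI)
  qed
  also have "\<dots> = ennreal c * L2_norm_sq \<Omega> f"
    using meas by (simp add: L2_norm_sq_eq nn_integral_cmult)
  also have "\<dots> < \<infinity>"
    using f by (simp add: L2_space_def ennreal_mult_less_top)
  finally show "f \<in> dual_L2s_space \<Omega> s"
    using f by (simp add: dual_L2s_space_def L2_space_def)
qed

lemma energy_zero_imp_AE_zero:
  assumes v: "v \<in> V_space \<Omega> s" and "B v v = 0"
  shows "AE x in lebesgue. v x = 0"
proof -
  have [measurable]: "v \<in> borel_measurable lebesgue"
    using v by (rule V_space_measurable)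
  obtain K where "(\<integral>\<^sup>+x. ennreal ((v x)\<^sup>2 / tail_weight s x) \<partial>lebesgue) \<le> ennreal (K * B v v)"
    using weighted_L2_le_energy v by blast
  then have "(\<integral>\<^sup>+x. ennreal ((v x)\<^sup>2 / tail_weight s x) \<partial>lebesgue) = 0"
    using assms by simp
  then have "AE x in lebesgue. ennreal ((v x)\<^sup>2 / tail_weight s x) = 0"
    by (subst (asm) nn_integral_0_iff_AE) auto
  then show ?thesis
  proof eventually_elim
    case (elim x)
    then have "(v x)\<^sup>2 / tail_weight s x \<le> 0" by (simp add: ennreal_eq_0_iff)
    then show ?case using tail_weight_pos[of s x] by (simp add: divide_le_0_iff)
  qed
qed

end

theorem lemma2p2:
  fixes \<Omega> :: "'a::euclidean_space set" and s \<alpha> :: real and f g :: "'a \<Rightarrow> real"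
  assumes "bounded_Lipschitz_domain \<Omega>"
    and "0 < s" and "s < 1" and "0 < \<alpha>"
    and "f \<in> L2_space \<Omega>"
    and "g \<in> dual_L2s_space (exterior \<Omega>) s"
  shows "\<exists>u. weak_solution \<Omega> s \<alpha> f g u \<and>
           (\<forall>w. weak_solution \<Omega> s \<alpha> f g w \<longrightarrow> (AE x in lebesgue. w x = u x))"
proof -
  interpret nonlocal_Neumann \<Omega> s \<alpha> "frac_const DIM('a) s / 2"
    using assms by unfold_locales (auto simp: bounded_Lipschitz_domain_def)
  define F where "F v = L2_inner \<Omega> f v + L2_inner (exterior \<Omega>) g v" for v
  have f: "f \<in> dual_L2s_space \<Omega> s" using assms(5) L2_space_subset_dual by blast
  note g = assms(6)
  have weak: "weak_solution \<Omega> s \<alpha> f g u \<longleftrightarrow> u \<in> V_space \<Omega> s \<and> (\<forall>v\<in>V_space \<Omega> s. B u v = F v)" for u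
    by (simp add: weak_solution_def energy_form_def F_def)
  \<comment> \<open>The energy is shared equally between the two loads, so that their sum costs one \<open>B v v\<close>.\<close>
  obtain C1 where C1: "\<And>v. v \<in> V_space \<Omega> s \<Longrightarrow> 2 * L2_inner \<Omega> f v \<le> C1 + 1/2 * B v v"
    using L2_inner_dual_bound[OF f, of "1/2"] by auto
  obtain C2 where C2: "\<And>v. v \<in> V_space \<Omega> s \<Longrightarrow> 2 * L2_inner (exterior \<Omega>) g v \<le> C2 + 1/2 * B v v"
    using L2_inner_dual_bound[OF g, of "1/2"] by auto
  have "\<exists>u\<in>V_space \<Omega> s. \<forall>v\<in>V_space \<Omega> s. B u v = F v"
  proof (rule Riesz_representation_by_minimisation[where K = "C1 + C2"])
    show "V_space \<Omega> s \<noteq> {}" using zero_in_V_space by blast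
    show "F (\<lambda>x. u x + t * v x) = F u + t * F v" if "u \<in> V_space \<Omega> s" "v \<in> V_space \<Omega> s" for u v t
      using L2_inner_dual_lincomb[OF f that] L2_inner_dual_lincomb[OF g that]
      by (simp add: F_def algebra_simps)
    show "2 * F v \<le> B v v + (C1 + C2)" if "v \<in> V_space \<Omega> s" for v
      using C1[OF that] C2[OF that] by (simp add: F_def)
    show "B u v = B v u" for u v by (rule energy_form_sym)
    show "\<exists>u\<in>V_space \<Omega> s. (\<lambda>n. B (\<lambda>x. u x - X n x) (\<lambda>x. u x - X n x)) \<longlonglongrightarrow> 0"
      if "\<And>n. X n \<in> V_space \<Omega> s"
        and "\<And>m n. n \<le> m \<Longrightarrow> B (\<lambda>x. X m x - X n x) (\<lambda>x. X m x - X n x) \<le> (1/4) ^ n" for X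
      using that by (rule V_space_complete)
  qed (fact V_space_lincomb energy_form_lincomb energy_form_nonneg)+
  then obtain u where u: "u \<in> V_space \<Omega> s" and sol: "\<And>v. v \<in> V_space \<Omega> s \<Longrightarrow> B u v = F v"
    by blast
  have "AE x in lebesgue. w x = u x" if "weak_solution \<Omega> s \<alpha> f g w" for w
  proof -
    have w: "w \<in> V_space \<Omega> s" and "\<And>v. v \<in> V_space \<Omega> s \<Longrightarrow> B w v = F v"
      using that by (auto simp: weak)
    define d where "d = (\<lambda>x. w x - u x)"
    have d: "d \<in> V_space \<Omega> s" unfolding d_def using w u by (rule V_space_diff)
    have "B d d = B w d + (-1) * B u d"
      using energy_form_lincomb[OF w u d, of "-1"] by (simp add: d_def)
    also have "\<dots> = 0" using sol[OF d] \<open>\<And>v. v \<in> V_space \<Omega> s \<Longrightarrow> B w v = F v\<close>[OF d] by simp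
    finally have "AE x in lebesgue. d x = 0" by (rule energy_zero_imp_AE_zero[OF d])
    then show ?thesis by (simp add: d_def)
  qed
  with u sol show ?thesis using weak by blast
qed


end
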